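(* Suppose that $\lambda_1\ge\dots\ge\lambda_{\tilde d}$, $\lambda_d>0$ and $\lambda_d>\lambda_{d+1}$. Let $n\in\{1,\dots,\ell\}$, let $\gamma_1>\dots>\gamma_n$ be the roots of $\pi_n$, and let $\sigma\in\mathbb{R}^{\tilde d-d}$ be the vector defined in the context (for this $n$). If $z$ is a root of $\tilde\pi_n$, then $$\min_{i=1,\dots,n}\Big|1-\frac{z}{\gamma_i}\Big|\le\|\sigma\|_1,$$ where $\|\sigma\|_1=|\sigma_{d+1}|+\dots+|\sigma_{\tilde d}|$.
   Context: Let $\tilde d\ge d$ be positive integers, $\lambda_1,\dots,\lambda_{\tilde d}\in\mathbb{R}$ and $b_1,\dots,b_{\tilde d}\in\mathbb{R}$. Let $A=\mathrm{diag}(\lambda_1,\dots,\lambda_d)$ and $b=(b_1,\dots,b_d)^\top$. The grade $\ell$ of $(A,b)$ is the largest integer $n$ such that $\mathrm{span}\{b,Ab,\dots,A^{n-1}b\}$ has dimension $n$. $\mathcal{P}_{\le n}$ is the space of real univariate polynomials of degree at most $n$. On polynomials define $$\langle p,q\rangle=\sum_{i=1}^d b_i^2p(\lambda_i)q(\lambda_i),\qquad\langle p,q\rangle_\sim=\sum_{i=1}^{\tilde d}b_i^2p(\lambda_i)q(\lambda_i),$$ with induced semi-norms $\|\cdot\|$ and $\|\cdot\|_\sim$. For $n\le\ell$, $\pi_n$ (resp. $\tilde\pi_n$) is the unique minimizer of $\|\pi\|^2$ (resp. $\|\pi\|_\sim^2$) over $\pi\in\mathcal{P}_{\le n}$ whose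 coefficient of degree $n$ equals $1$; the roots of $\pi_n$ and of $\tilde\pi_n$ are real and distinct. For $d<j\le\tilde d$ and $0\le n<\ell$, $\zeta_n^j$ is the unique minimizer of $\|\zeta\|^2$ over $\zeta\in\mathcal{P}_{\le n}$ subject to $\zeta(\lambda_j)=1$. Under the stated assumptions on the $\lambda_i$, all roots of $\pi_n$ and $\zeta_n^j$ are real and positive; define $\varsigma_n=\pi_n/\pi_n(0)$ and $\xi_n^j=\zeta_n^j/\zeta_n^j(0)$. Definition of $\sigma$ (for a given $n\in\{1,\dots,\ell\}$; indices $i,j$ run over $\{d+1,\dots,\tilde d\}$): $B=\mathrm{diag}(b_{d+1},\dots,b_{\tilde d})$, $C_{ij}=\xi_{n-1}^j(\lambda_i)$, $D$ diagonal with $D_{jj}=\|\xi_{n-1}^j\|^2/\xi_{n-1}^j(\lambda_j)$, $w_i=\varsigma_n(\lambda_i)$, and $\sigma=(D+B^2C)^{-1}B^2w$ (the inverse exists). *)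

theory Defs
  imports "Jordan_Normal_Form.DL_Rank" "Jordan_Normal_Form.Gauss_Jordan_Elimination"
begin

text \<open>The data are functions \<open>lam, b :: nat \<Rightarrow> real\<close>, read on the indices \<open>1, \<dots>, d'\<close>, where
  \<open>d'\<close> is the larger dimension. Vectors and matrices are indexed from 0,
  so entry \<open>i\<close> belongs to index \<open>i + 1\<close> (or \<open>d + 1 + i\<close> for the trailing block).\<close>

definition (in vec_space) span_dim :: "'a vec set \<Rightarrow> nat" where
  "span_dim S = vectorspace.dim class_ring (span_vs S)"

definition coeff_mat :: "nat \<Rightarrow> (nat \<Rightarrow> real) \<Rightarrow> real mat" where
  "coeff_mat d lam = mat_diag d (\<lambda>i. lam (i + 1))"

definition rhs_vec :: "nat \<Rightarrow> (nat \<Rightarrow> real) \<Rightarrow> real vec" where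
  "rhs_vec d b = vec d (\<lambda>i. b (i + 1))"

definition grade :: "real mat \<Rightarrow> real vec \<Rightarrow> nat" where
  "grade A v = (GREATEST n.
     vec_space.span_dim (dim_vec v) ((\<lambda>k. (A ^\<^sub>m k) *\<^sub>v v) ` {..<n}) = n)"

text \<open>With \<open>m = d\<close> this is the product of the smaller system, with \<open>m = d'\<close> that of the larger.\<close>

definition ip :: "nat \<Rightarrow> (nat \<Rightarrow> real) \<Rightarrow> (nat \<Rightarrow> real) \<Rightarrow> real poly \<Rightarrow> real poly \<Rightarrow> real" where
  "ip m lam b p q = (\<Sum>i = 1..m. (b i)\<^sup>2 * poly p (lam i) * poly q (lam i))"

definition seminorm :: "nat \<Rightarrow> (nat \<Rightarrow> real) \<Rightarrow> (nat \<Rightarrow> real) \<Rightarrow> real poly \<Rightarrow> real" where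
  "seminorm m lam b p = sqrt (ip m lam b p p)"

definition monic_min :: "nat \<Rightarrow> (nat \<Rightarrow> real) \<Rightarrow> (nat \<Rightarrow> real) \<Rightarrow> nat \<Rightarrow> real poly" where
  "monic_min m lam b n = (THE p. is_arg_min (\<lambda>p. (seminorm m lam b p)\<^sup>2)
     (\<lambda>p. degree p \<le> n \<and> poly.coeff p n = 1) p)"

definition zeta :: "nat \<Rightarrow> (nat \<Rightarrow> real) \<Rightarrow> (nat \<Rightarrow> real) \<Rightarrow> nat \<Rightarrow> nat \<Rightarrow> real poly" where
  "zeta d lam b n j = (THE p. is_arg_min (\<lambda>p. (seminorm d lam b p)\<^sup>2)
     (\<lambda>p. degree p \<le> n \<and> poly p (lam j) = 1) p)"

definition normalize0 :: "real poly \<Rightarrow> real poly" where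
  "normalize0 p = Polynomial.smult (1 / poly p 0) p"

definition varsigma :: "nat \<Rightarrow> (nat \<Rightarrow> real) \<Rightarrow> (nat \<Rightarrow> real) \<Rightarrow> nat \<Rightarrow> real poly" where
  "varsigma d lam b n = normalize0 (monic_min d lam b n)"

definition xi :: "nat \<Rightarrow> (nat \<Rightarrow> real) \<Rightarrow> (nat \<Rightarrow> real) \<Rightarrow> nat \<Rightarrow> nat \<Rightarrow> real poly" where
  "xi d lam b n j = normalize0 (zeta d lam b n j)"

definition B_mat :: "nat \<Rightarrow> nat \<Rightarrow> (nat \<Rightarrow> real) \<Rightarrow> real mat" where
  "B_mat d d' b = mat_diag (d' - d) (\<lambda>i. b (d + 1 + i))"

definition C_mat :: "nat \<Rightarrow> nat \<Rightarrow> (nat \<Rightarrow> real) \<Rightarrow> (nat \<Rightarrow> real) \<Rightarrow> nat \<Rightarrow> real mat" where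
  "C_mat d d' lam b n = mat (d' - d) (d' - d)
     (\<lambda>(i, j). poly (xi d lam b (n - 1) (d + 1 + j)) (lam (d + 1 + i)))"

definition D_mat :: "nat \<Rightarrow> nat \<Rightarrow> (nat \<Rightarrow> real) \<Rightarrow> (nat \<Rightarrow> real) \<Rightarrow> nat \<Rightarrow> real mat" where
  "D_mat d d' lam b n = mat_diag (d' - d)
     (\<lambda>j. (seminorm d lam b (xi d lam b (n - 1) (d + 1 + j)))\<^sup>2
          / poly (xi d lam b (n - 1) (d + 1 + j)) (lam (d + 1 + j)))"

definition w_vec :: "nat \<Rightarrow> nat \<Rightarrow> (nat \<Rightarrow> real) \<Rightarrow> (nat \<Rightarrow> real) \<Rightarrow> nat \<Rightarrow> real vec" where
  "w_vec d d' lam b n = vec (d' - d) (\<lambda>i. poly (varsigma d lam b n) (lam (d + 1 + i)))"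

definition sigma_vec :: "nat \<Rightarrow> nat \<Rightarrow> (nat \<Rightarrow> real) \<Rightarrow> (nat \<Rightarrow> real) \<Rightarrow> nat \<Rightarrow> real vec" where
  "sigma_vec d d' lam b n =
     the (mat_inverse (D_mat d d' lam b n + B_mat d d' b ^\<^sub>m 2 * C_mat d d' lam b n))
       *\<^sub>v (B_mat d d' b ^\<^sub>m 2 *\<^sub>v w_vec d d' lam b n)"

definition l1_norm :: "real vec \<Rightarrow> real" where
  "l1_norm v = (\<Sum>i<dim_vec v. \<bar>v $ i\<bar>)"

end

theory Submission
  imports Defs
begin

text \<open>The polynomial \<open>\<zeta>\<^sub>n\<^sub>-\<^sub>1\<^sup>j\<close> is, up to scaling, the reproducing kernel of
  \<open>\<P>\<^sub>\<le>\<^sub>n\<^sub>-\<^sub>1\<close> at \<open>\<lambda>\<^sub>j\<close>. Orthogonality of the larger system's \<open>\<pi>\<^sub>n\<close> to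
  \<open>\<P>\<^sub>\<le>\<^sub>n\<^sub>-\<^sub>1\<close> therefore says that, after division by \<open>\<pi>\<^sub>n(0)\<close>, it equals
  \<open>\<varsigma>\<^sub>n - \<Sum>\<^sub>j \<sigma>\<^sub>j \<xi>\<^sub>n\<^sub>-\<^sub>1\<^sup>j\<close>, and evaluating at the \<open>\<lambda>\<^sub>i\<close> with \<open>i > d\<close> gives the linear
  system that defines \<open>\<sigma>\<close>. So \<open>\<varsigma>\<^sub>n(z) = \<Sum>\<^sub>j \<sigma>\<^sub>j \<xi>\<^sub>n\<^sub>-\<^sub>1\<^sup>j(z)\<close> at a root \<open>z\<close>.

  The Lagrange polynomials \<open>Q\<^sub>i = \<varsigma>\<^sub>n / (1 - x/\<gamma>\<^sub>i)\<close> are pairwise orthogonal, and pairing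
  \<open>\<xi>\<^sub>n\<^sub>-\<^sub>1\<^sup>j = \<Sum>\<^sub>i c\<^sub>i Q\<^sub>i\<close> with \<open>Q\<^sub>i\<close> shows \<open>c\<^sub>i > 0\<close>, because \<open>Q\<^sub>i(\<lambda>\<^sub>j) > 0\<close> for \<open>\<lambda>\<^sub>j\<close> below
  all roots. Evaluation at 0 gives \<open>\<Sum>\<^sub>i c\<^sub>i = 1\<close>, hence
  \<open>min\<^sub>i \<bar>1 - z/\<gamma>\<^sub>i\<bar> \<bar>\<xi>\<^sub>n\<^sub>-\<^sub>1\<^sup>j(z)\<bar> \<le> \<bar>\<varsigma>\<^sub>n(z)\<bar>\<close>, and the bound follows.\<close>

section \<open>Minimizers of the semi-norms\<close>

text \<open>The form in which the grade hypothesis enters everything that follows: no nonzero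
  polynomial of degree below \<open>N\<close> has semi-norm zero, so minimizers become orthogonal
  projections.\<close>

definition pos_def_below :: "nat \<Rightarrow> (nat \<Rightarrow> real) \<Rightarrow> (nat \<Rightarrow> real) \<Rightarrow> nat \<Rightarrow> bool" where
  "pos_def_below m lam b N \<longleftrightarrow> (\<forall>p. degree p < N \<longrightarrow> p \<noteq> 0 \<longrightarrow> 0 < ip m lam b p p)"

lemma ip_add_left: "ip m lam b (p + q) r = ip m lam b p r + ip m lam b q r"
  by (simp add: ip_def algebra_simps sum.distrib)

lemma ip_add_right: "ip m lam b r (p + q) = ip m lam b r p + ip m lam b r q"
  by (simp add: ip_def algebra_simps sum.distrib)

lemma ip_diff_left: "ip m lam b (p - q) r = ip m lam b p r - ip m lam b q r"
  by (simp add: ip_def algebra_simps sum_subtractf)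

lemma ip_diff_right: "ip m lam b r (p - q) = ip m lam b r p - ip m lam b r q"
  by (simp add: ip_def algebra_simps sum_subtractf)

lemma ip_smult_left: "ip m lam b (Polynomial.smult c p) r = c * ip m lam b p r"
  by (simp add: ip_def algebra_simps sum_distrib_left)

lemma ip_smult_right: "ip m lam b r (Polynomial.smult c p) = c * ip m lam b r p"
  by (simp add: ip_def algebra_simps sum_distrib_left)

lemma ip_sum_left: "ip m lam b (\<Sum>i\<in>I. f i) r = (\<Sum>i\<in>I. ip m lam b (f i) r)"
  by (induction I rule: infinite_finite_induct) (simp_all add: ip_add_left, simp_all add: ip_def)

lemmas ip_bilinear =
  ip_add_left ip_add_right ip_diff_left ip_diff_right ip_smult_left ip_smult_right

lemma ip_commute: "ip m lam b p q = ip m lam b q p"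
  by (simp add: ip_def mult_ac)

lemma ip_mult_shift: "ip m lam b (p * q) r = ip m lam b p (q * r)"
  by (simp add: ip_def mult_ac)

lemma ip_self_nonneg: "0 \<le> ip m lam b p p"
  by (auto simp: ip_def mult.assoc intro!: sum_nonneg)

lemma seminorm_squared: "(seminorm m lam b p)\<^sup>2 = ip m lam b p p"
  by (simp add: seminorm_def ip_self_nonneg)

lemma ip_split:
  assumes "d \<le> d'"
  shows "ip d' lam b p q = ip d lam b p q +
    (\<Sum>k<d' - d. (b (d + 1 + k))\<^sup>2 * poly p (lam (d + 1 + k)) * poly q (lam (d + 1 + k)))"
proof -
  have "{1..d'} = {1..d} \<union> {d+1..d'}" using assms by auto
  then have "ip d' lam b p q = ip d lam b p q
      + (\<Sum>i = d+1..d'. (b i)\<^sup>2 * poly p (lam i) * poly q (lam i))"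
    by (simp add: ip_def sum.union_disjoint)
  also have "(\<Sum>i = d+1..d'. (b i)\<^sup>2 * poly p (lam i) * poly q (lam i)) =
    (\<Sum>k<d' - d. (b (d + 1 + k))\<^sup>2 * poly p (lam (d + 1 + k)) * poly q (lam (d + 1 + k)))"
    using assms
    by (intro sum.reindex_bij_witness[of _ "\<lambda>k. d + 1 + k" "\<lambda>i. i - (d + 1)"]) auto
  finally show ?thesis .
qed

lemma pos_def_below_mono:
  assumes "pos_def_below m lam b N" "M \<le> N"
  shows "pos_def_below m lam b M"
  using assms unfolding pos_def_below_def by auto

text \<open>The additional summands are squares. This makes the lemmas on minimizers available for
  the larger system too.\<close>

lemma pos_def_below_larger:
  assumes "pos_def_below d lam b N" "d \<le> d'"
  shows "pos_def_below d' lam b N"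
proof -
  have "ip d lam b p p \<le> ip d' lam b p p" for p
    unfolding ip_split[OF assms(2)] by (auto simp: mult.assoc intro!: sum_nonneg)
  then show ?thesis
    using assms(1) unfolding pos_def_below_def by (meson less_le_trans)
qed

lemma degree_less_iff_coeff:
  assumes "0 < N"
  shows "degree p < N \<longleftrightarrow> (\<forall>i\<ge>N. poly.coeff p i = 0)"
proof
  assume "\<forall>i\<ge>N. poly.coeff p i = 0"
  then have "degree p \<le> N - 1"
    using assms by (intro degree_le) auto
  then show "degree p < N" using assms by simp
qed (auto intro: coeff_eq_0)

text \<open>Bounds are put on the coefficients rather than on the degree because the zero
  polynomial has degree 0, which would spoil the base case.\<close>

lemma riesz_representation:
  assumes "pos_def_below m lam b N"
    and add: "\<And>p q. \<phi> (p + q) = \<phi> p + \<phi> q"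
    and smult: "\<And>c p. \<phi> (Polynomial.smult c p) = c * \<phi> p"
  shows "\<exists>k. (\<forall>i\<ge>N. poly.coeff k i = 0) \<and>
    (\<forall>q. (\<forall>i\<ge>N. poly.coeff q i = 0) \<longrightarrow> ip m lam b k q = (\<phi> q :: real))"
  using assms
proof (induction N arbitrary: \<phi>)
  case 0
  have "\<phi> 0 = 0" using "0.prems"(3)[of 0 0] by simp
  then have "ip m lam b 0 q = \<phi> q" if "\<forall>i. poly.coeff q i = 0" for q
    using that poly_eq_iff[of q 0] by (simp add: ip_def)
  then show ?case by (intro exI[of _ 0]) simp
next
  case (Suc N)
  note pd = Suc.prems(1)
  have pd': "pos_def_below m lam b N"
    using pd by (rule pos_def_below_mono) simp
  \<comment> \<open>A Gram-Schmidt step: \<open>e\<close> is the monomial minus its projection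
    \<open>h\<close> to lower degrees, and \<open>h\<close> comes from the induction hypothesis
    applied to pairing with the monomial.\<close>
  define X :: "real poly" where "X = Polynomial.monom 1 N"
  obtain k where k: "\<forall>i\<ge>N. poly.coeff k i = 0"
    "\<And>q. \<forall>i\<ge>N. poly.coeff q i = 0 \<Longrightarrow> ip m lam b k q = \<phi> q"
    using Suc.IH[OF pd' Suc.prems(2,3)] by blast
  obtain h where h: "\<forall>i\<ge>N. poly.coeff h i = 0"
    "\<And>q. \<forall>i\<ge>N. poly.coeff q i = 0 \<Longrightarrow> ip m lam b h q = ip m lam b X q"
    using Suc.IH[OF pd', of "ip m lam b X"] by (auto simp: ip_bilinear)
  define e where "e = X - h"
  have e_coeff: "poly.coeff e N = 1" "\<forall>i\<ge>Suc N. poly.coeff e i = 0"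
    using h(1) by (simp_all add: e_def X_def)
  have e_orth: "ip m lam b e q = 0" if "\<forall>i\<ge>N. poly.coeff q i = 0" for q
    using h(2)[OF that] by (simp add: e_def ip_bilinear)
  have "0 < ip m lam b e e"
    using pd e_coeff unfolding pos_def_below_def
    by (metis coeff_0 degree_less_iff_coeff zero_less_Suc zero_neq_one)
  \<comment> \<open>Since \<open>e\<close> is orthogonal to all lower degrees, adding a multiple of
    it keeps the values of \<open>k\<close> there; the factor is chosen so that pairing with
    \<open>e\<close> gives \<open>\<phi> e\<close>.\<close>
  define k' where "k' = k + Polynomial.smult (\<phi> e / ip m lam b e e) e"
  have "ip m lam b k' q = \<phi> q" if q: "\<forall>i\<ge>Suc N. poly.coeff q i = 0" for q
  proof -
    define r where "r = q - Polynomial.smult (poly.coeff q N) e"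
    have r: "\<forall>i\<ge>N. poly.coeff r i = 0"
    proof (intro allI impI)
      fix i assume "N \<le> i"
      then consider "i = N" | "Suc N \<le> i" by linarith
      then show "poly.coeff r i = 0" using q e_coeff by cases (simp_all add: r_def)
    qed
    have q_eq: "q = r + Polynomial.smult (poly.coeff q N) e"
      by (simp add: r_def)
    have "ip m lam b k e = 0"
      using e_orth[OF k(1)] by (simp add: ip_commute)
    then have "ip m lam b k' (r + Polynomial.smult c e) = \<phi> (r + Polynomial.smult c e)" for c
      using e_orth[OF r] k(2)[OF r] \<open>0 < ip m lam b e e\<close> Suc.prems(2,3)
      by (simp add: k'_def ip_bilinear)
    then show ?thesis using q_eq by metis
  qed
  moreover have "\<forall>i\<ge>Suc N. poly.coeff k' i = 0"
    using k(1) e_coeff by (simp add: k'_def)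
  ultimately show ?case by blast
qed

text \<open>Pythagoras: the cross term vanishes, so each competitor exceeds \<open>p\<close> by the
  squared semi-norm of its difference from \<open>p\<close>. This evaluates the \<open>THE\<close>
  in \<open>monic_min\<close> and \<open>zeta\<close>.\<close>

lemma is_arg_min_orthogonal_unique:
  assumes "P p" and "\<And>q. P q \<Longrightarrow> ip m lam b p (q - p) = 0"
    and "\<And>q. P q \<Longrightarrow> q \<noteq> p \<Longrightarrow> 0 < ip m lam b (q - p) (q - p)"
  shows "(THE p. is_arg_min (\<lambda>p. (seminorm m lam b p)\<^sup>2) P p) = p"
proof -
  have pyth: "ip m lam b q q = ip m lam b p p + ip m lam b (q - p) (q - p)" if "P q" for q
    using assms(2)[OF that] ip_commute[of m lam b q p] by (simp add: ip_bilinear)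
  show ?thesis
  proof (rule the_equality)
    show "is_arg_min (\<lambda>p. (seminorm m lam b p)\<^sup>2) P p"
    proof -
      have "ip m lam b p p \<le> ip m lam b q q" if "P q" for q
        using pyth[OF that] ip_self_nonneg[of m lam b "q - p"] by linarith
      then show ?thesis
        using assms(1) by (auto simp: is_arg_min_def seminorm_squared not_less)
    qed
  next
    fix q assume "is_arg_min (\<lambda>p. (seminorm m lam b p)\<^sup>2) P q"
    then have "P q" "\<not> ip m lam b p p < ip m lam b q q"
      using assms(1) by (auto simp: is_arg_min_def seminorm_squared)
    then show "q = p"
      using pyth[of q] assms(3)[of q] by linarith
  qed
qed

text \<open>Definiteness below \<open>n\<close> suffices, although the polynomial has degree
  \<open>n\<close>: two monic candidates differ by a polynomial of degree less than
  \<open>n\<close>. This admits \<open>n\<close> equal to the grade.\<close>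

lemma monic_min_orthogonal:
  assumes pd: "pos_def_below m lam b n" and "0 < n"
  shows "degree (monic_min m lam b n) = n" "poly.coeff (monic_min m lam b n) n = 1"
    "degree q < n \<Longrightarrow> ip m lam b (monic_min m lam b n) q = 0"
proof -
  define X :: "real poly" where "X = Polynomial.monom 1 n"
  obtain h where h: "\<forall>i\<ge>n. poly.coeff h i = 0"
    "\<And>q. \<forall>i\<ge>n. poly.coeff q i = 0 \<Longrightarrow> ip m lam b h q = ip m lam b X q"
    using riesz_representation[OF pd, of "ip m lam b X"] by (auto simp: ip_bilinear)
  define p where "p = X - h"
  have coeff: "poly.coeff p n = 1" and "\<forall>i\<ge>Suc n. poly.coeff p i = 0"
    using h(1) by (simp_all add: p_def X_def)
  then have deg: "degree p = n"
    by (metis degree_less_iff_coeff le_degree less_Suc_eq_le nle_le zero_less_Suc zero_neq_one)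
  have orth: "ip m lam b p q = 0" if "degree q < n" for q
    using h(2)[of q] that degree_less_iff_coeff[OF \<open>0 < n\<close>, of q]
    by (simp add: p_def ip_bilinear)
  have diff: "degree (q - p) < n" if "degree q \<le> n" "poly.coeff q n = 1" for q
    using that deg coeff degree_less_iff_coeff[OF \<open>0 < n\<close>, of "q - p"]
    by (auto simp: le_eq_less_or_eq coeff_eq_0)
  have "monic_min m lam b n = p"
    unfolding monic_min_def
    by (rule is_arg_min_orthogonal_unique)
      (use coeff deg orth diff pd in \<open>auto simp: pos_def_below_def\<close>)
  then show "degree (monic_min m lam b n) = n" "poly.coeff (monic_min m lam b n) n = 1"
    "degree q < n \<Longrightarrow> ip m lam b (monic_min m lam b n) q = 0"
    using coeff deg orth by simp_all
qed

text \<open>The minimizer is the Riesz representer \<open>k\<close> of evaluation at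
  \<open>lam j\<close>, rescaled to have value 1 there. Pairing \<open>k\<close> with itself gives
  \<open>poly k (lam j)\<close>, which is therefore positive.\<close>

lemma zeta_reproducing:
  assumes pd: "pos_def_below m lam b (Suc n)"
  shows "degree (zeta m lam b n j) \<le> n" "poly (zeta m lam b n j) (lam j) = 1"
    "degree q \<le> n \<Longrightarrow> ip m lam b (zeta m lam b n j) q =
      ip m lam b (zeta m lam b n j) (zeta m lam b n j) * poly q (lam j)"
    "0 < ip m lam b (zeta m lam b n j) (zeta m lam b n j)"
proof -
  obtain k where "\<forall>i\<ge>Suc n. poly.coeff k i = 0"
    "\<And>q. \<forall>i\<ge>Suc n. poly.coeff q i = 0 \<Longrightarrow> ip m lam b k q = poly q (lam j)"
    using riesz_representation[OF pd, of "\<lambda>p. poly p (lam j)"] by auto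
  then have k: "degree k \<le> n" "\<And>q. degree q \<le> n \<Longrightarrow> ip m lam b k q = poly q (lam j)"
    using degree_less_iff_coeff[of "Suc n", simplified less_Suc_eq_le] by blast+
  \<comment> \<open>Evaluation of the constant 1 is not zero.\<close>
  have "k \<noteq> 0" using k(2)[of 1] by (auto simp: ip_def)
  then have pos: "0 < poly k (lam j)"
    using k pd unfolding pos_def_below_def by (metis less_Suc_eq_le)
  define z where "z = Polynomial.smult (1 / poly k (lam j)) k"
  have z: "degree z \<le> n" "poly z (lam j) = 1"
    using k pos by (simp_all add: z_def)
  have repr: "ip m lam b z q = poly q (lam j) / poly k (lam j)" if "degree q \<le> n" for q
    using k(2)[OF that] by (simp add: z_def ip_bilinear)
  have "zeta m lam b n j = z"
    unfolding zeta_def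
  proof (rule is_arg_min_orthogonal_unique)
    fix q assume q: "degree q \<le> n \<and> poly q (lam j) = 1"
    then have deg: "degree (q - z) \<le> n" using z by (simp add: degree_diff_le)
    then show "ip m lam b z (q - z) = 0" using repr z q by simp
    show "0 < ip m lam b (q - z) (q - z)" if "q \<noteq> z"
      using pd deg that by (simp add: pos_def_below_def)
  qed (use z in simp)
  then show "degree (zeta m lam b n j) \<le> n" "poly (zeta m lam b n j) (lam j) = 1"
    "degree q \<le> n \<Longrightarrow> ip m lam b (zeta m lam b n j) q =
      ip m lam b (zeta m lam b n j) (zeta m lam b n j) * poly q (lam j)"
    "0 < ip m lam b (zeta m lam b n j) (zeta m lam b n j)"
    using z repr pos by simp_all
qed

text \<open>With weights strictly positive at the nodes, the weighted sum vanishes only if every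
  \<open>b i * poly q (lam i)\<close> does, and then \<open>q\<close> itself has semi-norm
  zero.\<close>

lemma ip_weighted_pos:
  assumes pd: "pos_def_below m lam b N" and "degree q < N" "q \<noteq> 0"
    and s: "\<And>i. i \<in> {1..m} \<Longrightarrow> 0 < poly s (lam i)"
  shows "0 < ip m lam b q (s * q)"
proof -
  define f where "f i = (b i)\<^sup>2 * poly q (lam i) * poly (s * q) (lam i)" for i
  have f: "f i = poly s (lam i) * (b i * poly q (lam i))\<^sup>2" for i
    by (simp add: f_def power2_eq_square)
  have nonneg: "0 \<le> f i" if "i \<in> {1..m}" for i
    using s[OF that] by (simp add: f less_imp_le)
  have "ip m lam b q (s * q) \<noteq> 0"
  proof
    assume "ip m lam b q (s * q) = 0"
    then have "(\<Sum>i = 1..m. f i) = 0" by (simp add: ip_def f_def)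
    then have "\<forall>i\<in>{1..m}. f i = 0"
      using nonneg by (subst (asm) sum_nonneg_eq_0_iff) auto
    then have "b i * poly q (lam i) = 0" if "i \<in> {1..m}" for i
      using s[OF that] that by (fastforce simp: f)
    then have "ip m lam b q q = 0"
      by (fastforce simp: ip_def intro: sum.neutral)
    then show False using pd assms(2,3) by (auto simp: pos_def_below_def)
  qed
  moreover have "0 \<le> ip m lam b q (s * q)"
    using nonneg by (auto simp: ip_def f_def intro!: sum_nonneg)
  ultimately show ?thesis by simp
qed

text \<open>Splitting off a root \<open>x\<close> leaves a cofactor \<open>q\<close> of degree below
  \<open>n\<close>, orthogonal to the whole polynomial; but their product is a sum with the positive
  weights \<open>lam i - x\<close>.\<close>

lemma monic_min_root_not_below:
  assumes pd: "pos_def_below m lam b n" and "0 < n"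
    and x: "\<And>i. i \<in> {1..m} \<Longrightarrow> x < lam i"
  shows "poly (monic_min m lam b n) x \<noteq> 0"
proof
  assume "poly (monic_min m lam b n) x = 0"
  then obtain q where q: "monic_min m lam b n = [:-x, 1:] * q"
    by (auto simp: poly_eq_0_iff_dvd)
  have "q \<noteq> 0" using monic_min_orthogonal(2)[OF pd \<open>0 < n\<close>] q by auto
  then have deg: "degree q < n"
    using monic_min_orthogonal(1)[OF pd \<open>0 < n\<close>] by (simp add: q degree_mult_eq del: mult_pCons_left)
  then have "ip m lam b ([:-x, 1:] * q) q = 0"
    using monic_min_orthogonal(3)[OF pd \<open>0 < n\<close>] q by metis
  moreover have "0 < ip m lam b q ([:-x, 1:] * q)"
    by (rule ip_weighted_pos[OF pd deg \<open>q \<noteq> 0\<close>]) (use x in simp)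
  ultimately show False by (simp add: ip_commute)
qed

text \<open>There is no root \<open>y\<close> below the nodes: replacing its factor by one vanishing
  at \<open>lam j\<close> gives a polynomial orthogonal to \<open>zeta\<close>, against the positive
  weights \<open>(lam i - y) * (lam i - lam j)\<close>. The value 1 at \<open>lam j\<close> then
  fixes the sign.\<close>

lemma zeta_pos_below:
  assumes pd: "pos_def_below m lam b (Suc n)"
    and x: "\<And>i. i \<in> {1..m} \<Longrightarrow> x < lam i"
    and j: "\<And>i. i \<in> {1..m} \<Longrightarrow> lam j < lam i"
  shows "0 < poly (zeta m lam b n j) x"
proof -
  have nz: "poly (zeta m lam b n j) y \<noteq> 0" if y: "\<And>i. i \<in> {1..m} \<Longrightarrow> y < lam i" for y
  proof
    assume "poly (zeta m lam b n j) y = 0"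
    then obtain q where q: "zeta m lam b n j = [:-y, 1:] * q"
      by (auto simp: poly_eq_0_iff_dvd)
    have "q \<noteq> 0" using zeta_reproducing(2)[OF pd, of j] q by auto
    then have deg: "degree ([:-lam j, 1:] * q) \<le> n" "degree q < Suc n"
      using zeta_reproducing(1)[OF pd, of j]
      by (simp_all add: q degree_mult_eq del: mult_pCons_left)
    have "ip m lam b ([:-y, 1:] * q) ([:-lam j, 1:] * q) = 0"
      using zeta_reproducing(3)[OF pd deg(1), of j] by (simp add: q)
    then have "ip m lam b q (([:-y, 1:] * [:-lam j, 1:]) * q) = 0"
      by (metis ip_mult_shift mult.assoc mult.commute)
    moreover have "0 < poly ([:-y, 1:] * [:-lam j, 1:]) (lam i)" if "i \<in> {1..m}" for i
      unfolding poly_mult using y[OF that] j[OF that] by (intro mult_pos_pos) simp_all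
    then have "0 < ip m lam b q (([:-y, 1:] * [:-lam j, 1:]) * q)"
      by (rule ip_weighted_pos[OF pd deg(2) \<open>q \<noteq> 0\<close>])
    ultimately show False by simp
  qed
  show ?thesis
  proof (rule ccontr)
    assume "\<not> 0 < poly (zeta m lam b n j) x"
    then have neg: "poly (zeta m lam b n j) x < 0" using nz[OF x] by simp
    have one: "poly (zeta m lam b n j) (lam j) = 1" by (rule zeta_reproducing(2)[OF pd])
    \<comment> \<open>A sign change between \<open>x\<close> and \<open>lam j\<close> yields a root
      between them, hence still below all nodes.\<close>
    have "\<exists>y. poly (zeta m lam b n j) y = 0 \<and> (y < x \<or> y < lam j)"
    proof (cases "x < lam j")
      case True
      then show ?thesis using poly_IVT_pos[OF True, of "zeta m lam b n j"] neg one by auto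
    next
      case False
      with neg one have "lam j < x" by (cases "x = lam j") auto
      then show ?thesis using poly_IVT_neg[of "lam j" x "zeta m lam b n j"] neg one by auto
    qed
    then show False using nz x j by (meson order.strict_trans)
  qed
qed

text \<open>A trivial kernel gives a nonzero determinant, so \<open>mat_inverse\<close> returns a
  \<open>Some\<close>. A solution of the linear system is thereby identified with the inverse
  applied to the right-hand side.\<close>

lemma mat_inverse_mult_vec:
  fixes M :: "'a::field mat"
  assumes M: "M \<in> carrier_mat N N"
    and inj: "\<And>v. v \<in> carrier_vec N \<Longrightarrow> M *\<^sub>v v = 0\<^sub>v N \<Longrightarrow> v = 0\<^sub>v N"
    and x: "x \<in> carrier_vec N"
  shows "the (mat_inverse M) *\<^sub>v (M *\<^sub>v x) = x"
proof -
  have "det M \<noteq> 0" using det_0_iff_vec_prod_zero[OF M] inj by auto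
  then have "M \<in> Units (ring_mat TYPE('a) N ())" by (rule det_non_zero_imp_unit[OF M])
  then obtain M' where M': "mat_inverse M = Some M'"
    using mat_inverse(1)[OF M, of "()"] by (cases "mat_inverse M") auto
  then have inv: "M' * M = 1\<^sub>m N" "M' \<in> carrier_mat N N"
    using mat_inverse(2)[OF M] by auto
  then have "M' *\<^sub>v (M *\<^sub>v x) = (M' * M) *\<^sub>v x"
    using M x by (metis assoc_mult_mat_vec)
  then show ?thesis using M' inv x by simp
qed

section \<open>The grade and positive definiteness\<close>

text \<open>The dimension is the size of a maximal independent subset, hence at most the number of
  distinct vectors, which is at most \<open>N\<close>; equality excludes repetitions and dependence.
  The bound by \<open>n\<close> makes the \<open>GREATEST\<close> in \<open>grade\<close>
  exist.\<close>

lemma (in vec_space) full_span_dim_imp_inj_lin_indpt: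
  assumes v: "\<And>k. k < N \<Longrightarrow> v k \<in> carrier_vec n" and dim: "span_dim (v ` {..<N}) = N"
  shows "inj_on v {..<N}" "lin_indpt (v ` {..<N})" "N \<le> n"
proof -
  let ?S = "v ` {..<N}"
  have S: "?S \<subseteq> carrier_vec n" "finite ?S" using v by auto
  obtain U where U: "finite U" "maximal U (\<lambda>T. T \<subseteq> ?S \<and> lin_indpt T)"
    using maximal_exists[of "\<lambda>T. T \<subseteq> ?S \<and> lin_indpt T" "card ?S" "{}"] S(2)
    by (meson card_mono empty_iff empty_subsetI finite_lin_indpt2 rev_finite_subset finite.emptyI)
  then have "N = card U" using dim_span[OF S U(2)] dim by (simp add: span_dim_def)
  also have "\<dots> \<le> card ?S" using U(2) S(2) by (auto simp: maximal_def intro: card_mono)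
  finally have card: "card ?S = N"
    using card_image_le[of "{..<N}" v] by simp
  then show "inj_on v {..<N}" by (simp add: eq_card_imp_inj_on)
  show indpt: "lin_indpt ?S"
    by (rule full_dim_span[OF S]) (use dim card in \<open>simp add: span_dim_def\<close>)
  show "N \<le> n" using li_le_dim(2)[OF fin_dim _ indpt] S(1) card dim_is_n by simp
qed

lemma pow_coeff_mat_mult_rhs_vec:
  "coeff_mat d lam ^\<^sub>m k *\<^sub>v rhs_vec d b = vec d (\<lambda>i. lam (i + 1) ^ k * b (i + 1))"
proof -
  have "mat_diag d f ^\<^sub>m k = mat_diag d (\<lambda>i. f i ^ k)" for f :: "nat \<Rightarrow> real"
    by (induction k) (simp_all add: mat_diag_def[of d "\<lambda>i. 1"] one_mat_def mult.commute, simp add: mat_diag_def)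
  then have "coeff_mat d lam ^\<^sub>m k = mat_diag d (\<lambda>i. lam (i + 1) ^ k)"
    by (simp add: coeff_mat_def)
  moreover have "(\<Sum>j = 0..<d. (if i = j then lam (Suc j) ^ k else 0) * b (Suc j)) =
      lam (Suc i) ^ k * b (Suc i)" if "i < d" for i
    using that by (subst sum.remove[of _ i]) auto
  ultimately show ?thesis
    by (intro eq_vecI) (simp_all add: rhs_vec_def mat_diag_def scalar_prod_def)
qed

text \<open>Semi-norm zero means \<open>b i * poly p (lam i) = 0\<close> for all \<open>i\<close>,
  that is p(A)b = 0. This is a linear relation among the Krylov vectors with the coefficients of
  \<open>p\<close>, and below the grade these vectors are independent.\<close>

lemma pos_def_below_grade:
  "pos_def_below d lam b (grade (coeff_mat d lam) (rhs_vec d b))"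
proof -
  interpret vec_space "TYPE(real)" d .
  define v where "v k = coeff_mat d lam ^\<^sub>m k *\<^sub>v rhs_vec d b" for k
  define g where "g = grade (coeff_mat d lam) (rhs_vec d b)"
  have v: "v k = vec d (\<lambda>i. lam (i + 1) ^ k * b (i + 1))" for k
    by (simp add: v_def pow_coeff_mat_mult_rhs_vec)
  have v_carrier: "v k \<in> carrier_vec d" for k by (simp add: v)
  have g: "g = (GREATEST N. span_dim (v ` {..<N}) = N)"
    by (simp add: g_def grade_def v_def rhs_vec_def)
  have "span_dim (v ` {..<0}) = 0"
  proof -
    have "maximal {} (\<lambda>T. T \<subseteq> {} \<and> lin_indpt T)"
      by (auto simp: maximal_def lin_dep_def)
    then show ?thesis using dim_span[of "{}" "{}"] by (simp add: span_dim_def)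
  qed
  moreover have "N \<le> d" if "span_dim (v ` {..<N}) = N" for N
    using full_span_dim_imp_inj_lin_indpt(3)[OF _ that] v_carrier by blast
  ultimately have dim: "span_dim (v ` {..<g}) = g"
    unfolding g by (rule GreatestI_nat)
  have inj: "inj_on v {..<g}" and indpt: "lin_indpt (v ` {..<g})"
    using full_span_dim_imp_inj_lin_indpt[OF v_carrier dim] by blast+
  have "p = 0" if deg: "degree p < g" and zero: "ip d lam b p p = 0" for p
  proof -
    \<comment> \<open>\<open>lincomb\<close> takes coefficients indexed by vectors, so the exponent
      is recovered from the vector by injectivity.\<close>
    define a where "a w = poly.coeff p (the_inv_into {..<g} v w)" for w
    have a: "a (v k) = poly.coeff p k" if "k < g" for k
      using that by (simp add: a_def the_inv_into_f_f[OF inj])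
    have p_sum: "poly p x = (\<Sum>k<g. poly.coeff p k * x ^ k)" for x
      unfolding poly_altdef using deg by (intro sum.mono_neutral_left) (auto simp: coeff_eq_0)
    have "\<forall>i\<in>{1..d}. (b i)\<^sup>2 * poly p (lam i) * poly p (lam i) = 0"
      using zero unfolding ip_def by (subst (asm) sum_nonneg_eq_0_iff) (auto simp: mult.assoc)
    then have bp: "b (i + 1) * poly p (lam (i + 1)) = 0" if "i < d" for i
      using that by auto
    have "lincomb a (v ` {..<g}) = 0\<^sub>v d"
    proof (rule eq_vecI)
      fix i assume "i < dim_vec (0\<^sub>v d :: real vec)"
      then have i: "i < d" by simp
      have "lincomb a (v ` {..<g}) $ i = (\<Sum>w\<in>v ` {..<g}. a w * w $ i)"
        by (rule lincomb_index[OF i]) (auto simp: v_carrier)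
      also have "\<dots> = (\<Sum>k<g. poly.coeff p k * (lam (i + 1) ^ k * b (i + 1)))"
        unfolding sum.reindex[OF inj] using i by (intro sum.cong) (simp_all add: a, simp add: v)
      also have "\<dots> = b (i + 1) * poly p (lam (i + 1))"
        by (simp add: p_sum sum_distrib_left mult_ac)
      finally show "lincomb a (v ` {..<g}) $ i = 0\<^sub>v d $ i" using bp i by simp
    next
      have "dim_vec (lincomb a (v ` {..<g})) = d"
        by (rule lincomb_dim) (auto simp: v_carrier)
      then show "dim_vec (lincomb a (v ` {..<g})) = dim_vec (0\<^sub>v d :: real vec)" by simp
    qed
    then have "a \<in> v ` {..<g} \<rightarrow> {0}"
      using not_lindepD[OF indpt _ subset_refl, of a] by (simp add: module_vec_simps class_ring_simps)
    then have "poly.coeff p k = 0" if "k < g" for k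
      using a[OF that] that by (metis Pi_mem imageI lessThan_iff singletonD)
    then show "p = 0" using deg leading_coeff_0_iff by blast
  qed
  then show ?thesis
    unfolding pos_def_below_def g_def[symmetric]
    using ip_self_nonneg by (metis less_eq_real_def)
qed

section \<open>Expansion of the perturbed polynomial\<close>

text \<open>Of the ordering of the nodes only the separation of the tail from the first
  \<open>d\<close> nodes is kept. Tail indices start at 0, as in the vectors and matrices.\<close>

locale separated_extension =
  fixes d d' n :: nat and lam b :: "nat \<Rightarrow> real"
  assumes d_le: "d \<le> d'" and n_pos: "0 < n"
    and pd: "pos_def_below d lam b n"
    and lam_pos: "\<And>i. i \<in> {1..d} \<Longrightarrow> 0 < lam i"
    and tail_less: "\<And>i k. i \<in> {1..d} \<Longrightarrow> k < d' - d \<Longrightarrow> lam (d + 1 + k) < lam i"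
begin

abbreviation \<mu> :: "nat \<Rightarrow> real" where "\<mu> k \<equiv> lam (d + 1 + k)"
abbreviation \<beta> :: "nat \<Rightarrow> real" where "\<beta> k \<equiv> b (d + 1 + k)"
abbreviation \<xi> :: "nat \<Rightarrow> real poly" where "\<xi> k \<equiv> xi d lam b (n - 1) (d + 1 + k)"
abbreviation \<V> :: "real poly" where "\<V> \<equiv> varsigma d lam b n"

text \<open>The diagonal of D, and at the same time the constant in the reproducing property of
  \<open>\<xi> k\<close> (last claim of \<open>xi_props\<close>).\<close>

definition \<delta> :: "nat \<Rightarrow> real" where
  "\<delta> k = (seminorm d lam b (\<xi> k))\<^sup>2 / poly (\<xi> k) (\<mu> k)"

lemma degree_lt_iff: "degree q < n \<longleftrightarrow> degree q \<le> n - 1"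
  using n_pos by linarith

lemma pd_Suc: "pos_def_below d lam b (Suc (n - 1))"
  using pd n_pos by simp

lemma zeta_zero_pos:
  assumes "k < d' - d"
  shows "0 < poly (zeta d lam b (n - 1) (d + 1 + k)) 0"
  by (rule zeta_pos_below[OF pd_Suc]) (use lam_pos tail_less assms in auto)

lemma xi_props:
  assumes k: "k < d' - d"
  shows "degree (\<xi> k) < n" "poly (\<xi> k) 0 = 1" "0 < \<delta> k"
    "degree q < n \<Longrightarrow> ip d lam b (\<xi> k) q = \<delta> k * poly q (\<mu> k)"
proof -
  define z where "z = zeta d lam b (n - 1) (d + 1 + k)"
  have z0: "0 < poly z 0" using zeta_zero_pos[OF k] by (simp add: z_def)
  note z = zeta_reproducing[OF pd_Suc, where j = "d + 1 + k", folded z_def]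
  have xi: "\<xi> k = Polynomial.smult (1 / poly z 0) z"
    by (simp add: xi_def normalize0_def z_def)
  have delta: "\<delta> k = ip d lam b z z / poly z 0"
    unfolding \<delta>_def seminorm_squared xi using z(2) z0 by (simp add: ip_bilinear)
  show "degree (\<xi> k) < n" "poly (\<xi> k) 0 = 1"
    unfolding degree_lt_iff xi using z(1) z0 by simp_all
  show "0 < \<delta> k" using z(4) z0 by (simp add: delta)
  show "ip d lam b (\<xi> k) q = \<delta> k * poly q (\<mu> k)" if "degree q < n"
    unfolding xi delta using z(3)[of q] that by (simp add: ip_bilinear degree_lt_iff)
qed

lemma monic_min_zero_nz: "poly (monic_min d lam b n) 0 \<noteq> 0"
  by (rule monic_min_root_not_below[OF pd n_pos]) (rule lam_pos)

lemma varsigma_zero: "poly \<V> 0 = 1"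
  using monic_min_zero_nz by (simp add: varsigma_def normalize0_def)

lemma varsigma_orthogonal: "degree q < n \<Longrightarrow> ip d lam b \<V> q = 0"
  using monic_min_orthogonal(3)[OF pd n_pos]
  by (simp add: varsigma_def normalize0_def ip_bilinear)

lemma eq_zero_if_self_ip_le_zero:
  assumes "degree q < n" "ip d lam b q q \<le> 0"
  shows "q = 0"
  using pd assms unfolding pos_def_below_def by fastforce

text \<open>For a kernel vector \<open>x\<close> and the combination \<open>f\<close> of the
  \<open>\<xi> l\<close>, the system turns \<open>ip d lam b f f\<close> into minus a sum of
  squares, so \<open>f = 0\<close>. The \<open>\<xi> l\<close> may be linearly dependent; what
  remains of the system, \<open>\<delta> k * x k = 0\<close>, gives the claim.\<close>

lemma xi_system_trivial_kernel:
  assumes x: "\<And>k. k < d' - d \<Longrightarrow>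
      \<delta> k * x k + (\<beta> k)\<^sup>2 * (\<Sum>l<d' - d. x l * poly (\<xi> l) (\<mu> k)) = 0"
    and k: "k < d' - d"
  shows "x k = 0"
proof -
  define f where "f = (\<Sum>l<d' - d. Polynomial.smult (x l) (\<xi> l))"
  have deg: "degree f < n"
    unfolding f_def using xi_props(1) n_pos
    by (intro degree_sum_less) (auto intro: le_less_trans[OF degree_smult_le])
  have f: "poly f t = (\<Sum>l<d' - d. x l * poly (\<xi> l) t)" for t
    by (simp add: f_def poly_sum)
  have "ip d lam b f f = (\<Sum>l<d' - d. x l * (\<delta> l * poly f (\<mu> l)))"
    using xi_props(4)[OF _ deg] by (subst f_def) (simp add: ip_sum_left ip_smult_left)
  also have "\<dots> = (\<Sum>l<d' - d. - (\<beta> l * poly f (\<mu> l))\<^sup>2)"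
  proof (rule sum.cong)
    fix l assume "l \<in> {..<d' - d}"
    then have "\<delta> l * x l = - ((\<beta> l)\<^sup>2 * poly f (\<mu> l))" using x[of l] by (simp add: f)
    then have "(\<delta> l * x l) * poly f (\<mu> l) = - (\<beta> l * poly f (\<mu> l))\<^sup>2"
      by (simp add: power2_eq_square)
    then show "x l * (\<delta> l * poly f (\<mu> l)) = - (\<beta> l * poly f (\<mu> l))\<^sup>2"
      by (simp add: mult_ac)
  qed simp
  also have "\<dots> \<le> 0" by (intro sum_nonpos) simp
  finally have "f = 0" by (rule eq_zero_if_self_ip_le_zero[OF deg])
  then have "(\<Sum>l<d' - d. x l * poly (\<xi> l) (\<mu> k)) = 0"
    using f[of "\<mu> k"] by simp
  then show ?thesis using x[OF k] xi_props(3)[OF k] by simp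
qed

text \<open>Both monic minimizers are divided by the same number, so the leading terms of
  \<open>\<S>\<close> and \<open>\<V>\<close> cancel in the difference.\<close>

definition \<S> :: "real poly" where
  "\<S> = Polynomial.smult (1 / poly (monic_min d lam b n) 0) (monic_min d' lam b n)"

definition s :: "nat \<Rightarrow> real" where
  "s k = (\<beta> k)\<^sup>2 * poly \<S> (\<mu> k) / \<delta> k"

text \<open>The choice of \<open>s\<close> makes pairing with the sum \<open>f\<close> equal to the
  tail part of the larger product with \<open>\<S>\<close>. So \<open>r = \<S> - \<V> + f\<close>,
  of degree below \<open>n\<close>, pairs with itself to the difference of two vanishing
  orthogonality terms.\<close>

lemma perturbed_expansion: "\<S> = \<V> - (\<Sum>k<d' - d. Polynomial.smult (s k) (\<xi> k))"
proof -
  define c where "c = 1 / poly (monic_min d lam b n) 0"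
  note pd' = pos_def_below_larger[OF pd d_le]
  define f where "f = (\<Sum>k<d' - d. Polynomial.smult (s k) (\<xi> k))"
  have f_deg: "degree f < n"
    unfolding f_def using xi_props(1) n_pos
    by (intro degree_sum_less) (auto intro: le_less_trans[OF degree_smult_le])
  have S_orth: "ip d' lam b \<S> q = 0" if "degree q < n" for q
    using monic_min_orthogonal(3)[OF pd' n_pos that] by (simp add: \<S>_def ip_bilinear)
  have diff_deg: "degree (monic_min d' lam b n - monic_min d lam b n) < n"
    using monic_min_orthogonal(1,2)[OF pd n_pos] monic_min_orthogonal(1,2)[OF pd' n_pos]
    by (auto simp: degree_less_iff_coeff[OF n_pos] le_eq_less_or_eq coeff_eq_0)
  have SV: "\<S> - \<V> = Polynomial.smult c (monic_min d' lam b n - monic_min d lam b n)"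
    by (simp add: \<S>_def varsigma_def normalize0_def c_def smult_diff_right)
  define r where "r = \<S> - \<V> + f"
  have deg: "degree r < n"
    unfolding r_def SV using diff_deg f_deg
    by (intro degree_add_less) (auto intro: le_less_trans[OF degree_smult_le])
  have "ip d lam b f r = (\<Sum>k<d' - d. s k * (\<delta> k * poly r (\<mu> k)))"
    unfolding f_def using xi_props(4)[OF _ deg] by (simp add: ip_sum_left ip_smult_left)
  also have "\<dots> = (\<Sum>k<d' - d. (\<beta> k)\<^sup>2 * poly \<S> (\<mu> k) * poly r (\<mu> k))"
    using xi_props(3) by (intro sum.cong) (fastforce simp: s_def)+
  finally have "ip d lam b r r = ip d' lam b \<S> r - ip d lam b \<V> r"
    by (subst r_def) (simp add: ip_bilinear ip_split[OF d_le, of _ _ \<S>])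
  then have "r = 0"
    using S_orth[OF deg] varsigma_orthogonal[OF deg] eq_zero_if_self_ip_le_zero[OF deg] by simp
  then show ?thesis by (simp add: r_def f_def algebra_simps)
qed

text \<open>By definition \<open>\<delta> k * s k\<close> is
  \<open>(\<beta> k)\<^sup>2 * poly \<S> (\<mu> k)\<close>; inserting the expansion of
  \<open>\<S>\<close> at \<open>\<mu> k\<close> gives row \<open>k\<close> of the system.\<close>

lemma sigma_vec_eq: "sigma_vec d d' lam b n = vec (d' - d) s"
proof -
  define N where "N = d' - d"
  define M where "M = D_mat d d' lam b n + B_mat d d' b ^\<^sub>m 2 * C_mat d d' lam b n"
  have B2: "B_mat d d' b ^\<^sub>m 2 = mat_diag N (\<lambda>k. (\<beta> k)\<^sup>2)"
    by (simp add: B_mat_def N_def numeral_2_eq_2 mat_diag_dim[THEN carrier_matD(1)])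
  have C: "C_mat d d' lam b n \<in> carrier_mat N N" by (simp add: C_mat_def N_def)
  have M: "M = mat N N (\<lambda>(k, l). (if k = l then \<delta> l else 0) + (\<beta> k)\<^sup>2 * poly (\<xi> l) (\<mu> k))"
    unfolding M_def B2 mat_diag_mult_left[OF C]
    by (rule eq_matI) (auto simp: D_mat_def C_mat_def mat_diag_def N_def \<delta>_def)
  have M_carrier: "M \<in> carrier_mat N N" by (simp add: M)
  have Mv: "(M *\<^sub>v v) $ k = \<delta> k * v $ k + (\<beta> k)\<^sup>2 * (\<Sum>l<N. v $ l * poly (\<xi> l) (\<mu> k))"
    if "v \<in> carrier_vec N" "k < N" for v k
  proof -
    have "(M *\<^sub>v v) $ k = (\<Sum>l<N. ((if k = l then \<delta> l else 0) + (\<beta> k)\<^sup>2 * poly (\<xi> l) (\<mu> k)) * v $ l)"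
      using that by (auto simp: M scalar_prod_def lessThan_atLeast0 intro!: sum.cong)
    also have "\<dots> = (\<Sum>l<N. (if k = l then \<delta> l * v $ l else 0)) +
        (\<Sum>l<N. (\<beta> k)\<^sup>2 * (v $ l * poly (\<xi> l) (\<mu> k)))"
      by (subst sum.distrib[symmetric], rule sum.cong) (auto simp: algebra_simps)
    finally show ?thesis using that(2) by (simp add: sum_distrib_left)
  qed
  have inj: "v = 0\<^sub>v N" if v: "v \<in> carrier_vec N" and "M *\<^sub>v v = 0\<^sub>v N" for v
  proof (rule eq_vecI)
    fix k assume "k < dim_vec (0\<^sub>v N :: real vec)"
    then have "k < N" by simp
    have "v $ k = 0"
    proof (rule xi_system_trivial_kernel[where x = "($) v"])
      fix l assume "l < d' - d"
      then have "l < N" by (simp add: N_def)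
      then show "\<delta> l * v $ l + (\<beta> l)\<^sup>2 * (\<Sum>i<d' - d. v $ i * poly (\<xi> i) (\<mu> l)) = 0"
        using Mv[OF v \<open>l < N\<close>] that(2) by (simp add: N_def)
    qed (use \<open>k < N\<close> N_def in simp)
    then show "v $ k = 0\<^sub>v N $ k" using \<open>k < N\<close> by simp
  qed (use v in simp)
  have "M *\<^sub>v vec N s = B_mat d d' b ^\<^sub>m 2 *\<^sub>v w_vec d d' lam b n"
  proof (rule eq_vecI)
    fix k assume "k < dim_vec (B_mat d d' b ^\<^sub>m 2 *\<^sub>v w_vec d d' lam b n)"
    then have k: "k < N" by (simp add: B2 mat_diag_def)
    then have k': "k < d' - d" by (simp add: N_def)
    have "(B_mat d d' b ^\<^sub>m 2 *\<^sub>v w_vec d d' lam b n) $ k =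
        (\<Sum>l<N. (if k = l then (\<beta> l)\<^sup>2 else 0) * poly \<V> (\<mu> l))"
      using k by (simp add: B2 mat_diag_def w_vec_def scalar_prod_def N_def lessThan_atLeast0
          cong: if_cong)
    also have "\<dots> = (\<Sum>l<N. if k = l then (\<beta> l)\<^sup>2 * poly \<V> (\<mu> l) else 0)"
      by (intro sum.cong) auto
    also have "\<dots> = (\<beta> k)\<^sup>2 * poly \<V> (\<mu> k)" using k by simp
    also have "poly \<V> (\<mu> k) = poly \<S> (\<mu> k) + (\<Sum>l<N. s l * poly (\<xi> l) (\<mu> k))"
      by (subst perturbed_expansion) (simp add: poly_sum N_def)
    finally show "(M *\<^sub>v vec N s) $ k = (B_mat d d' b ^\<^sub>m 2 *\<^sub>v w_vec d d' lam b n) $ k"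
      using xi_props(3)[OF k'] k by (simp add: Mv s_def[of k] distrib_left)
  qed (simp add: M B2 mat_diag_def)
  then show ?thesis
    using mat_inverse_mult_vec[OF M_carrier inj, of "vec N s"]
    by (simp add: sigma_vec_def M_def N_def)
qed

end

section \<open>The Lagrange basis at the roots\<close>

lemma degree_prod_linear_le:
  fixes c :: "'b \<Rightarrow> 'a::idom"
  shows "degree (\<Prod>i\<in>I. [:1, c i:]) \<le> card I"
proof (cases "finite I")
  case True
  then have "degree (\<Prod>i\<in>I. [:1, c i:]) \<le> (\<Sum>i\<in>I. degree [:1, c i:])"
    using degree_prod_sum_le[OF True, of "\<lambda>i. [:1, c i:]"] by (simp add: o_def)
  also have "\<dots> \<le> (\<Sum>i\<in>I. 1)" by (intro sum_mono) simp
  finally show ?thesis by simp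
qed simp

context separated_extension
begin

context
  fixes \<gamma> :: "nat \<Rightarrow> real"
  assumes inj: "inj_on \<gamma> {1..n}"
    and roots: "\<gamma> ` {1..n} = {x. poly (monic_min d lam b n) x = 0}"
begin

lemma ex_lam_le_root:
  assumes "i \<in> {1..n}"
  shows "\<exists>l\<in>{1..d}. lam l \<le> \<gamma> i"
proof -
  have "poly (monic_min d lam b n) (\<gamma> i) = 0" using roots assms by auto
  then show ?thesis
    using monic_min_root_not_below[OF pd n_pos, of "\<gamma> i"] by (meson not_le)
qed

lemma root_pos: "i \<in> {1..n} \<Longrightarrow> 0 < \<gamma> i"
  using ex_lam_le_root lam_pos by (meson less_le_trans)

lemma tail_less_root: "i \<in> {1..n} \<Longrightarrow> k < d' - d \<Longrightarrow> \<mu> k < \<gamma> i"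
  using ex_lam_le_root tail_less by (meson less_le_trans)

text \<open>Scaled to value 1 at 0 instead of at the root, so that coefficients in this basis sum to
  the value at 0.\<close>

definition Q :: "nat \<Rightarrow> real poly" where
  "Q i = (\<Prod>k\<in>{1..n} - {i}. [:1, - 1 / \<gamma> k:])"

text \<open>Both sides have degree at most \<open>n\<close> and agree at \<open>n + 1\<close>
  points: the roots, and 0, which is not a root.\<close>

lemma varsigma_prod: "\<V> = (\<Prod>k\<in>{1..n}. [:1, - 1 / \<gamma> k:])"
proof (rule poly_eqI_degree)
  have card: "card (insert 0 (\<gamma> ` {1..n})) = Suc n"
    using root_pos card_image[OF inj] by (subst card_insert_disjoint) force+
  show "degree \<V> < card (insert 0 (\<gamma> ` {1..n}))"
    unfolding card varsigma_def normalize0_def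
    using monic_min_orthogonal(1)[OF pd n_pos] by (simp add: less_Suc_eq_le)
  show "degree (\<Prod>k\<in>{1..n}. [:1, - 1 / \<gamma> k:]) < card (insert 0 (\<gamma> ` {1..n}))"
    unfolding card by (rule le_less_trans[OF degree_prod_linear_le]) simp
  show "poly \<V> x = poly (\<Prod>k\<in>{1..n}. [:1, - 1 / \<gamma> k:]) x"
    if x: "x \<in> insert 0 (\<gamma> ` {1..n})" for x
  proof (cases "x = 0")
    case True
    then show ?thesis by (simp add: varsigma_zero poly_prod)
  next
    case False
    then obtain i where i: "i \<in> {1..n}" "x = \<gamma> i" using x by auto
    then have "poly \<V> x = 0"
      using roots by (auto simp: varsigma_def normalize0_def)
    moreover have "(\<Prod>k\<in>{1..n}. poly [:1, - 1 / \<gamma> k:] x) = 0"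
      using i False by (intro prod_zero) auto
    ultimately show ?thesis by (simp add: poly_prod)
  qed
qed

lemma varsigma_factor: "i \<in> {1..n} \<Longrightarrow> \<V> = [:1, - 1 / \<gamma> i:] * Q i"
  unfolding varsigma_prod Q_def by (rule prod.remove) auto

lemma degree_Q: "i \<in> {1..n} \<Longrightarrow> degree (Q i) < n"
  unfolding Q_def using n_pos by (intro le_less_trans[OF degree_prod_linear_le]) simp

lemma poly_Q_zero: "poly (Q i) 0 = 1"
  by (simp add: Q_def poly_prod)

lemma poly_Q_root:
  assumes "i \<in> {1..n}" "k \<in> {1..n}"
  shows "poly (Q i) (\<gamma> k) = 0 \<longleftrightarrow> k \<noteq> i"
proof -
  have "1 - \<gamma> k / \<gamma> l = 0 \<longleftrightarrow> k = l" if "l \<in> {1..n}" for l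
    using root_pos[OF that] inj_onD[OF inj, of k l] assms(2) that by auto
  then show ?thesis using assms by (auto simp: Q_def poly_prod)
qed

lemma Q_tail_pos:
  assumes "i \<in> {1..n}" "k < d' - d"
  shows "0 < poly (Q i) (\<mu> k)"
  unfolding Q_def poly_prod
  by (rule prod_pos) (use root_pos tail_less_root[OF _ assms(2)] in auto)

text \<open>Moving the factor of \<open>\<gamma> i\<close> from \<open>Q k\<close> to
  \<open>Q i\<close> completes the latter to \<open>\<V>\<close>, which is orthogonal to the
  remaining cofactor.\<close>

lemma Q_orthogonal:
  assumes "i \<in> {1..n}" "k \<in> {1..n}" "i \<noteq> k"
  shows "ip d lam b (Q i) (Q k) = 0"
proof -
  define r where "r = (\<Prod>l\<in>{1..n} - {k} - {i}. [:1, - 1 / \<gamma> l:])"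
  have Qk: "Q k = [:1, - 1 / \<gamma> i:] * r"
    unfolding Q_def r_def using assms by (intro prod.remove) auto
  have "card ({1..n} - {k} - {i}) < n"
    using assms n_pos by (simp add: card_Diff_singleton_if)
  then have "degree r < n"
    unfolding r_def by (intro le_less_trans[OF degree_prod_linear_le]) auto
  then have "ip d lam b ([:1, - 1 / \<gamma> i:] * Q i) r = 0"
    using varsigma_orthogonal varsigma_factor[OF assms(1)] by metis
  then show ?thesis
    unfolding Qk by (metis ip_mult_shift mult.commute)
qed

lemma xi_convex_combination:
  assumes k: "k < d' - d"
  obtains c where "\<And>i. i \<in> {1..n} \<Longrightarrow> 0 < c i" "(\<Sum>i\<in>{1..n}. c i) = 1"
    "\<xi> k = (\<Sum>i\<in>{1..n}. Polynomial.smult (c i) (Q i))"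
proof
  \<comment> \<open>Interpolation at the roots: at \<open>\<gamma> i\<close> only \<open>Q i\<close>
    is nonzero.\<close>
  define c where "c i = poly (\<xi> k) (\<gamma> i) / poly (Q i) (\<gamma> i)" for i
  have card: "card (\<gamma> ` {1..n}) = n" using card_image[OF inj] by simp
  show xi: "\<xi> k = (\<Sum>i\<in>{1..n}. Polynomial.smult (c i) (Q i))"
  proof (rule poly_eqI_degree)
    show "degree (\<xi> k) < card (\<gamma> ` {1..n})" unfolding card by (rule xi_props(1)[OF k])
    show "degree (\<Sum>i\<in>{1..n}. Polynomial.smult (c i) (Q i)) < card (\<gamma> ` {1..n})"
      unfolding card using n_pos
      by (intro degree_sum_less) (auto intro!: le_less_trans[OF degree_smult_le] degree_Q)
    fix x assume "x \<in> \<gamma> ` {1..n}"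
    then obtain l where l: "l \<in> {1..n}" "x = \<gamma> l" by auto
    have "poly (\<Sum>i\<in>{1..n}. Polynomial.smult (c i) (Q i)) x =
        (\<Sum>i\<in>{1..n}. if i = l then poly (\<xi> k) x else 0)"
      unfolding poly_sum using l poly_Q_root by (intro sum.cong) (auto simp: c_def)
    then show "poly (\<xi> k) x = poly (\<Sum>i\<in>{1..n}. Polynomial.smult (c i) (Q i)) x"
      using l(1) by simp
  qed
  have "poly (\<xi> k) 0 = (\<Sum>i\<in>{1..n}. c i)"
    by (subst xi) (simp add: poly_sum poly_Q_zero)
  then show "(\<Sum>i\<in>{1..n}. c i) = 1" using xi_props(2)[OF k] by simp
  fix i assume i: "i \<in> {1..n}"
  have "ip d lam b (\<xi> k) (Q i) = (\<Sum>l\<in>{1..n}. if l = i then c i * ip d lam b (Q i) (Q i) else 0)"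
    by (subst xi, simp only: ip_sum_left ip_smult_left, intro sum.cong)
      (use Q_orthogonal i in auto)
  also have "\<dots> = c i * ip d lam b (Q i) (Q i)" using i by simp
  finally have "c i * ip d lam b (Q i) (Q i) = \<delta> k * poly (Q i) (\<mu> k)"
    using xi_props(4)[OF k degree_Q[OF i]] by simp
  also have "\<dots> > 0" using xi_props(3)[OF k] Q_tail_pos[OF i k] by simp
  finally show "0 < c i"
    using ip_self_nonneg[of d lam b "Q i"] by (auto simp: zero_less_mult_iff)
qed

lemma xi_bound:
  assumes k: "k < d' - d" and m: "\<And>i. i \<in> {1..n} \<Longrightarrow> m \<le> \<bar>1 - z / \<gamma> i\<bar>" and "0 \<le> m"
  shows "m * \<bar>poly (\<xi> k) z\<bar> \<le> \<bar>poly \<V> z\<bar>"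
proof -
  obtain c where c: "\<And>i. i \<in> {1..n} \<Longrightarrow> 0 < c i" "(\<Sum>i\<in>{1..n}. c i) = 1"
    and xi: "\<xi> k = (\<Sum>i\<in>{1..n}. Polynomial.smult (c i) (Q i))"
    using xi_convex_combination[OF k] by blast
  have "\<bar>poly (\<xi> k) z\<bar> \<le> (\<Sum>i\<in>{1..n}. c i * \<bar>poly (Q i) z\<bar>)"
    unfolding xi poly_sum
    by (rule order_trans[OF sum_abs], intro sum_mono) (use c(1) in \<open>simp add: abs_mult abs_of_pos\<close>)
  then have "m * \<bar>poly (\<xi> k) z\<bar> \<le> m * (\<Sum>i\<in>{1..n}. c i * \<bar>poly (Q i) z\<bar>)"
    using \<open>0 \<le> m\<close> by (rule mult_left_mono)
  also have "\<dots> = (\<Sum>i\<in>{1..n}. c i * (m * \<bar>poly (Q i) z\<bar>))"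
    by (simp add: sum_distrib_left mult_ac)
  also have "\<dots> \<le> (\<Sum>i\<in>{1..n}. c i * \<bar>poly \<V> z\<bar>)"
  proof (intro sum_mono mult_left_mono)
    fix i assume i: "i \<in> {1..n}"
    have "m * \<bar>poly (Q i) z\<bar> \<le> \<bar>1 - z / \<gamma> i\<bar> * \<bar>poly (Q i) z\<bar>"
      using m[OF i] by (rule mult_right_mono) simp
    also have "\<dots> = \<bar>poly ([:1, - 1 / \<gamma> i:] * Q i) z\<bar>"
      unfolding poly_mult abs_mult by simp
    finally show "m * \<bar>poly (Q i) z\<bar> \<le> \<bar>poly \<V> z\<bar>"
      using varsigma_factor[OF i] by simp
  qed (use c(1) less_imp_le in blast)
  also have "\<dots> = \<bar>poly \<V> z\<bar>" using c(2) by (simp flip: sum_distrib_right)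
  finally show ?thesis .
qed

lemma min_root_distance_le:
  assumes z: "poly (monic_min d' lam b n) z = 0"
  shows "Min ((\<lambda>i. \<bar>1 - z / \<gamma> i\<bar>) ` {1..n}) \<le> l1_norm (sigma_vec d d' lam b n)"
proof -
  define m where "m = Min ((\<lambda>i. \<bar>1 - z / \<gamma> i\<bar>) ` {1..n})"
  have m: "m \<le> \<bar>1 - z / \<gamma> i\<bar>" if "i \<in> {1..n}" for i
    unfolding m_def using that by (intro Min_le) auto
  have "0 \<le> m" unfolding m_def using n_pos by (subst Min_ge_iff) auto
  have norm: "l1_norm (sigma_vec d d' lam b n) = (\<Sum>k<d' - d. \<bar>s k\<bar>)"
    by (simp add: sigma_vec_eq l1_norm_def)
  have V: "poly \<V> z = (\<Sum>k<d' - d. s k * poly (\<xi> k) z)"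
    using z arg_cong[OF perturbed_expansion, of "\<lambda>p. poly p z"]
    by (simp add: \<S>_def poly_sum)
  show ?thesis
  \<comment> \<open>The main estimate is divided by the absolute value of \<open>\<V>\<close> at
    \<open>z\<close>. If that is zero, \<open>z\<close> is one of the \<open>\<gamma> i\<close> and
    the minimum is 0.\<close>
  proof (cases "poly \<V> z = 0")
    case True
    then obtain i where i: "i \<in> {1..n}" "1 - z / \<gamma> i = 0"
      by (auto simp: varsigma_prod poly_prod)
    have "m \<le> 0" using m[OF i(1)] i(2) by simp
    also have "0 \<le> l1_norm (sigma_vec d d' lam b n)" by (simp add: norm sum_nonneg)
    finally show ?thesis by (simp add: m_def)
  next
    case False
    have "m * \<bar>poly \<V> z\<bar> \<le> m * (\<Sum>k<d' - d. \<bar>s k\<bar> * \<bar>poly (\<xi> k) z\<bar>)"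
      unfolding V abs_mult[symmetric] using \<open>0 \<le> m\<close> by (intro mult_left_mono sum_abs)
    also have "\<dots> = (\<Sum>k<d' - d. \<bar>s k\<bar> * (m * \<bar>poly (\<xi> k) z\<bar>))"
      by (simp add: sum_distrib_left mult_ac)
    also have "\<dots> \<le> (\<Sum>k<d' - d. \<bar>s k\<bar> * \<bar>poly \<V> z\<bar>)"
      by (intro sum_mono mult_left_mono xi_bound m \<open>0 \<le> m\<close>) auto
    also have "\<dots> = l1_norm (sigma_vec d d' lam b n) * \<bar>poly \<V> z\<bar>"
      by (simp add: norm sum_distrib_right)
    finally show ?thesis using False by (simp add: m_def)
  qed
qed

end

end

theorem lemma3p4:
  fixes d d' n :: nat and lam b \<gamma> :: "nat \<Rightarrow> real" and z :: real
  assumes "0 < d" and "d \<le> d'"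
    and "\<And>i j. 1 \<le> i \<Longrightarrow> i \<le> j \<Longrightarrow> j \<le> d' \<Longrightarrow> lam j \<le> lam i"
    and "0 < lam d"
    and "d < d' \<Longrightarrow> lam (d + 1) < lam d"
    and "n \<in> {1..grade (coeff_mat d lam) (rhs_vec d b)}"
    and "\<And>i j. 1 \<le> i \<Longrightarrow> i < j \<Longrightarrow> j \<le> n \<Longrightarrow> \<gamma> j < \<gamma> i"
    and "\<gamma> ` {1..n} = {x. poly (monic_min d lam b n) x = 0}"
    and "poly (monic_min d' lam b n) z = 0"
  shows "Min ((\<lambda>i. \<bar>1 - z / \<gamma> i\<bar>) ` {1..n}) \<le> l1_norm (sigma_vec d d' lam b n)"
proof -
  have lam_ge: "lam d \<le> lam i" if "i \<in> {1..d}" for i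
    using that assms(2,3) by simp
  interpret separated_extension d d' n lam b
  proof
    show "pos_def_below d lam b n"
      using pos_def_below_mono[OF pos_def_below_grade] assms(6) by simp
    show "0 < lam i" if "i \<in> {1..d}" for i
      using lam_ge[OF that] assms(4) by simp
    fix i k assume i: "i \<in> {1..d}" and k: "k < d' - d"
    \<comment> \<open>The existence of a tail index \<open>k\<close> forces \<open>d < d'\<close>,
      which activates the gap assumption.\<close>
    have "lam (d + 1 + k) \<le> lam (d + 1)" using assms(3)[of "d + 1" "d + 1 + k"] k by simp
    also have "\<dots> < lam d" using assms(5) k by simp
    finally show "lam (d + 1 + k) < lam i" using lam_ge[OF i] by simp
  qed (use assms in auto)
  have "inj_on \<gamma> {1..n}"
    using assms(7) by (intro linorder_inj_onI) fastforce+
  then show ?thesis by (rule min_root_distance_le[OF _ assms(8,9)])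
qed

end
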